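(* For every feasible initial neighbourhood $\mathcal{N}_1\subset X\times Y$, the algorithm $\mathtt{solveSparse}$ terminates after a finite number of iterations and the coupling $\pi$ it returns is a global primal optimizer, i.e. it minimizes $C$ over all of $\Pi(\mu,\nu)$.
   Context: $X$, $Y$ are finite sets, $\mu$, $\nu$ are probability measures on $X$, $Y$, and $c : X \times Y \to \mathbb{R}\cup\{\infty\}$ is a cost function. $\Pi(\mu,\nu)$ is the set of couplings, i.e. probability measures $\pi$ on $X\times Y$ with marginals $\mu$ and $\nu$; $\mathrm{spt}\,\pi=\{(x,y) : \pi(x,y)>0\}$ and $C(\pi)=\sum_{(x,y)} c(x,y)\,\pi(x,y)$ (with $\infty\cdot 0=0$). A neighbourhood is a subset $\mathcal{N}\subset X\times Y$. The problem restricted to $\mathcal{N}$ is to minimize $C(\pi)$ over all $\pi\in\Pi(\mu,\nu)$ with $\mathrm{spt}\,\pi\subset\mathcal{N}$; $\mathcal{N}$ is feasible if the optimal value of this problem is finite, and a local primal optimizer w.r.t. $\mathcal{N}$ is a minimizer of this problem. Shielding condition: for $x_A\in X$, $(x_s,y_s)\in X\times Y$, $y_B\in Y$, we say that $(x_s,y_s)$ shields $x_A$ from $y_B$ when $$c(x_A,y_B)-c(x_s,y_B)>c(x_A,y_s)-c(x_s,y_s).$$ An inequality in which an expression $\infty-\infty$ occurs is regarded as not satisfied. Shielding neighbourhood: for a coupling $\pi$, a neighbourhood $\mathcal{N}\supset\mathrm{spt}\,\pi$ is shielding for $\pi$ if for every $(x_A,y_B)\in X\times Y$ at least one of the following holds: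 (i) $(x_A,y_B)\in\mathcal{N}$; (ii) there exists $(x_s,y_s)\in\mathrm{spt}\,\pi$ with $(x_A,y_s)\in\mathcal{N}$ such that $(x_s,y_s)$ shields $x_A$ from $y_B$. Two maps are given: $\mathtt{solveLocal}:2^{X\times Y}\to\Pi(\mu,\nu)$ such that for every feasible $\mathcal{N}$ the coupling $\mathtt{solveLocal}(\mathcal{N})$ is a local primal optimizer w.r.t. $\mathcal{N}$; and $\mathtt{shield}:\Pi(\mu,\nu)\to 2^{X\times Y}$ such that for every $\pi\in\Pi(\mu,\nu)$ the neighbourhood $\mathtt{shield}(\pi)$ is shielding for $\pi$. Algorithm $\mathtt{solveSparse}$ (input: feasible $\mathcal{N}_1$): set $k\leftarrow 1$. Repeat: $\pi_{k+1}\leftarrow\mathtt{solveLocal}(\mathcal{N}_k)$; $\mathcal{N}_{k+1}\leftarrow\mathtt{shield}(\pi_{k+1})$; $k\leftarrow k+1$; until ($k>2$ and $C(\pi_k)=C(\pi_{k-1})$), where the stopping test is performed at the end of each pass. Then return $(\pi_k,\mathcal{N}_k)$. *)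

theory Defs
  imports "HOL-Probability.Probability_Mass_Function" "HOL-Library.While_Combinator"
begin

text \<open>
  The finite sets \<open>X\<close> and \<open>Y\<close> are finite types; probability measures on them are
  probability mass functions, and the support of \<open>\<pi>\<close> is \<^const>\<open>set_pmf\<close> \<open>\<pi>\<close>.
  A cost function takes values in \<^typ>\<open>ereal\<close>; that it omits \<open>-\<infinity>\<close> is a separate hypothesis.
\<close>

definition couplings :: "'a pmf \<Rightarrow> 'b pmf \<Rightarrow> ('a \<times> 'b) pmf set" where
  "couplings \<mu> \<nu> = {\<pi>. map_pmf fst \<pi> = \<mu> \<and> map_pmf snd \<pi> = \<nu>}"

text \<open>In \<^typ>\<open>ereal\<close>, \<open>\<infinity> * 0 = 0\<close>.\<close>

definition transport_cost :: "('a::finite \<times> 'b::finite \<Rightarrow> ereal) \<Rightarrow> ('a \<times> 'b) pmf \<Rightarrow> ereal" where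
  "transport_cost c \<pi> = (\<Sum>p\<in>UNIV. c p * ereal (pmf \<pi> p))"

definition restricted_couplings ::
    "'a pmf \<Rightarrow> 'b pmf \<Rightarrow> ('a \<times> 'b) set \<Rightarrow> ('a \<times> 'b) pmf set" where
  "restricted_couplings \<mu> \<nu> N = {\<pi> \<in> couplings \<mu> \<nu>. set_pmf \<pi> \<subseteq> N}"

text \<open>The infimum over the empty set is \<open>\<infinity>\<close>, so a neighbourhood that supports no coupling
  is not feasible.\<close>

definition feasible ::
    "('a::finite \<times> 'b::finite \<Rightarrow> ereal) \<Rightarrow> 'a pmf \<Rightarrow> 'b pmf \<Rightarrow> ('a \<times> 'b) set \<Rightarrow> bool" where
  "feasible c \<mu> \<nu> N \<longleftrightarrow> \<bar>INF \<pi>\<in>restricted_couplings \<mu> \<nu> N. transport_cost c \<pi>\<bar> \<noteq> \<infinity>"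

definition local_primal_optimizer ::
    "('a::finite \<times> 'b::finite \<Rightarrow> ereal) \<Rightarrow> 'a pmf \<Rightarrow> 'b pmf \<Rightarrow> ('a \<times> 'b) set
      \<Rightarrow> ('a \<times> 'b) pmf \<Rightarrow> bool" where
  "local_primal_optimizer c \<mu> \<nu> N \<pi> \<longleftrightarrow>
     is_arg_min (transport_cost c) (\<lambda>\<rho>. \<rho> \<in> restricted_couplings \<mu> \<nu> N) \<pi>"

definition global_primal_optimizer ::
    "('a::finite \<times> 'b::finite \<Rightarrow> ereal) \<Rightarrow> 'a pmf \<Rightarrow> 'b pmf \<Rightarrow> ('a \<times> 'b) pmf \<Rightarrow> bool" where
  "global_primal_optimizer c \<mu> \<nu> \<pi> \<longleftrightarrow>
     is_arg_min (transport_cost c) (\<lambda>\<rho>. \<rho> \<in> couplings \<mu> \<nu>) \<pi>"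

text \<open>
  An inequality in which \<open>\<infinity> - \<infinity>\<close> occurs counts as not satisfied. Since \<open>\<infinity> - \<infinity> = \<infinity>\<close> in
  \<^typ>\<open>ereal\<close>, both differences have to be guarded.
\<close>

definition shields ::
    "('a \<times> 'b \<Rightarrow> ereal) \<Rightarrow> 'a \<times> 'b \<Rightarrow> 'a \<Rightarrow> 'b \<Rightarrow> bool" where
  "shields c s xA yB \<longleftrightarrow> (case s of (xs, ys) \<Rightarrow>
     \<not> (c (xA, yB) = \<infinity> \<and> c (xs, yB) = \<infinity>) \<and>
     \<not> (c (xA, ys) = \<infinity> \<and> c (xs, ys) = \<infinity>) \<and>
     c (xA, yB) - c (xs, yB) > c (xA, ys) - c (xs, ys))"

definition shielding ::
    "('a \<times> 'b \<Rightarrow> ereal) \<Rightarrow> ('a \<times> 'b) pmf \<Rightarrow> ('a \<times> 'b) set \<Rightarrow> bool" where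
  "shielding c \<pi> N \<longleftrightarrow> set_pmf \<pi> \<subseteq> N \<and>
     (\<forall>xA yB. (xA, yB) \<in> N \<or>
        (\<exists>xs ys. (xs, ys) \<in> set_pmf \<pi> \<and> (xA, ys) \<in> N \<and> shields c (xs, ys) xA yB))"

text \<open>
  The loop state is \<open>(k, \<pi>\<^sub>k\<^sub>-\<^sub>1, \<pi>\<^sub>k, N\<^sub>k)\<close>. The couplings with index below 2 do not exist; their
  slots hold \<^const>\<open>undefined\<close>, and the test \<open>k > 2\<close> keeps them from influencing the run.
\<close>

type_synonym ('a, 'b) sparse_state =
  "nat \<times> ('a \<times> 'b) pmf \<times> ('a \<times> 'b) pmf \<times> ('a \<times> 'b) set"

definition sparse_pass ::
    "(('a \<times> 'b) set \<Rightarrow> ('a \<times> 'b) pmf) \<Rightarrow> (('a \<times> 'b) pmf \<Rightarrow> ('a \<times> 'b) set)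
      \<Rightarrow> ('a, 'b) sparse_state \<Rightarrow> ('a, 'b) sparse_state" where
  "sparse_pass solveLocal shield = (\<lambda>(k, \<pi>', \<pi>, N).
     let \<rho> = solveLocal N in (k + 1, \<pi>, \<rho>, shield \<rho>))"

definition sparse_stop ::
    "('a::finite \<times> 'b::finite \<Rightarrow> ereal) \<Rightarrow> ('a, 'b) sparse_state \<Rightarrow> bool" where
  "sparse_stop c = (\<lambda>(k, \<pi>', \<pi>, N). k > 2 \<and> transport_cost c \<pi> = transport_cost c \<pi>')"

text \<open>\<open>repeat B until T\<close> is \<open>B; while \<not> T do B\<close>; the result \<^const>\<open>None\<close> means that the loop
  does not terminate.\<close>

definition solveSparse ::
    "('a::finite \<times> 'b::finite \<Rightarrow> ereal)
      \<Rightarrow> (('a \<times> 'b) set \<Rightarrow> ('a \<times> 'b) pmf) \<Rightarrow> (('a \<times> 'b) pmf \<Rightarrow> ('a \<times> 'b) set)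
      \<Rightarrow> ('a \<times> 'b) set \<Rightarrow> (('a \<times> 'b) pmf \<times> ('a \<times> 'b) set) option" where
  "solveSparse c solveLocal shield N\<^sub>1 =
     map_option (\<lambda>(k, \<pi>', \<pi>, N). (\<pi>, N))
       (while_option (\<lambda>s. \<not> sparse_stop c s) (sparse_pass solveLocal shield)
         (sparse_pass solveLocal shield (1, undefined, undefined, N\<^sub>1)))"

end

theory Submission
  imports Defs "HOL-Analysis.Polytope"
begin

text \<open>
  The heart of the matter is that a coupling \<open>\<pi>\<close> of finite cost that is optimal on a
  neighbourhood \<open>N\<close> shielding for \<open>\<pi>\<close> itself is globally optimal
  (\<open>shielded_local_optimizer_is_global\<close>). By linear programming duality, local optimality
  yields potentials \<open>\<alpha>\<close>, \<open>\<beta>\<close> with \<open>\<alpha> x + \<beta> y \<le> c (x, y)\<close> on \<open>N\<close> and equality on the support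
  of \<open>\<pi>\<close> (\<open>local_optimizer_has_potentials\<close>). Shielding carries the inequality over to all of
  \<open>X \<times> Y\<close>: if \<open>(x\<^sub>s, y\<^sub>s)\<close> shields \<open>x\<close> from \<open>y\<close>, then the slack \<open>c (x, y) - \<alpha> x - \<beta> y\<close>
  strictly decreases when \<open>x\<close> is replaced by \<open>x\<^sub>s\<close>. Hence in each column the slack attains its
  minimum at a cell of \<open>N\<close>, where it is nonnegative (\<open>shielding_extends_dual_feasibility\<close>).
  The potentials then certify global optimality, because the dual value depends on the
  marginals only (\<open>potentials_imp_global_optimizer\<close>).

  As for the algorithm, \<open>\<pi>\<^sub>k\<close> is admissible for the problem on \<open>shield \<pi>\<^sub>k\<close> that \<open>\<pi>\<^sub>k\<^sub>+\<^sub>1\<close> solves, so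
  from \<open>k = 2\<close> on the costs are finite and do not increase, and they decrease strictly until
  the stopping test succeeds. There are only finitely many neighbourhoods, hence finitely many
  possible costs, so the test succeeds eventually. It then
  says that \<open>\<pi>\<^sub>k\<^sub>-\<^sub>1\<close> has the optimal cost on \<open>shield \<pi>\<^sub>k\<^sub>-\<^sub>1\<close>, a neighbourhood shielding for
  \<open>\<pi>\<^sub>k\<^sub>-\<^sub>1\<close>. So \<open>\<pi>\<^sub>k\<^sub>-\<^sub>1\<close> is globally optimal, and \<open>\<pi>\<^sub>k\<close> is too since it costs the same.
\<close>

section \<open>Couplings and transport cost on finite sets\<close>

lemma pmf_map_fst_finite:
  fixes \<pi> :: "('a::finite \<times> 'b::finite) pmf"
  shows "pmf (map_pmf fst \<pi>) x = (\<Sum>y\<in>UNIV. pmf \<pi> (x, y))"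
proof -
  have "fst -` {x} = range (Pair x :: 'b \<Rightarrow> _)" by auto
  then show ?thesis
    by (simp add: pmf_map measure_measure_pmf_finite sum.reindex inj_on_def)
qed

lemma pmf_map_snd_finite:
  fixes \<pi> :: "('a::finite \<times> 'b::finite) pmf"
  shows "pmf (map_pmf snd \<pi>) y = (\<Sum>x\<in>UNIV. pmf \<pi> (x, y))"
proof -
  have "snd -` {y} = range (\<lambda>x::'a. (x, y))" by auto
  then show ?thesis
    by (simp add: pmf_map measure_measure_pmf_finite sum.reindex inj_on_def)
qed

lemma couplings_iff_sums:
  fixes \<pi> :: "('a::finite \<times> 'b::finite) pmf"
  shows "\<pi> \<in> couplings \<mu> \<nu> \<longleftrightarrow>
    (\<forall>x. (\<Sum>y\<in>UNIV. pmf \<pi> (x, y)) = pmf \<mu> x) \<and> (\<forall>y. (\<Sum>x\<in>UNIV. pmf \<pi> (x, y)) = pmf \<nu> y)"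
  by (simp add: couplings_def pmf_eq_iff pmf_map_fst_finite pmf_map_snd_finite)

lemma sum_UNIV_prod:
  fixes f :: "'a::finite \<times> 'b::finite \<Rightarrow> 'c::comm_monoid_add"
  shows "(\<Sum>p\<in>UNIV. f p) = (\<Sum>x\<in>UNIV. \<Sum>y\<in>UNIV. f (x, y))"
  by (simp add: sum.cartesian_product flip: UNIV_Times_UNIV)


text \<open>A bound that is uniform in \<open>\<pi>\<close>: it keeps the infimum over a neighbourhood away from
  \<open>-\<infinity>\<close>, so that feasibility amounts to the existence of one coupling of finite cost.\<close>

lemma transport_cost_bounded_below:
  assumes "\<And>p. c p \<noteq> -\<infinity>"
  shows "ereal (\<Sum>p\<in>UNIV. - \<bar>real_of_ereal (c p)\<bar>) \<le> transport_cost c \<pi>"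
proof -
  have "ereal (- \<bar>real_of_ereal (c p)\<bar>) \<le> c p * ereal (pmf \<pi> p)" for p
  proof (cases "c p")
    case (real r)
    have "\<bar>r\<bar> * pmf \<pi> p \<le> \<bar>r\<bar> * 1"
      by (intro mult_left_mono) (auto simp: pmf_le_1)
    moreover have "- \<bar>r\<bar> * pmf \<pi> p \<le> r * pmf \<pi> p"
      by (intro mult_right_mono) (auto simp: pmf_nonneg)
    ultimately show ?thesis using real by simp
  qed (use assms[of p] in \<open>auto simp: pmf_nonneg\<close>)
  then show ?thesis
    unfolding transport_cost_def sum_ereal[symmetric] by (intro sum_mono) simp
qed

lemma transport_cost_finite_imp_finite_on_support:
  assumes "\<And>p. c p \<noteq> -\<infinity>" "transport_cost c \<pi> \<noteq> \<infinity>" "p \<in> set_pmf \<pi>"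
  shows "\<bar>c p\<bar> \<noteq> \<infinity>"
proof
  assume "\<bar>c p\<bar> = \<infinity>"
  with assms(1)[of p] have "c p = \<infinity>" by auto
  with assms(3) have "c p * ereal (pmf \<pi> p) = \<infinity>"
    by (simp add: set_pmf_iff)
  then have "transport_cost c \<pi> = \<infinity>"
    unfolding transport_cost_def by (subst sum_Pinfty) (metis UNIV_I finite)
  with assms(2) show False by simp
qed

lemma transport_cost_eq_real_sum:
  assumes "\<And>p. p \<in> set_pmf \<pi> \<Longrightarrow> c p = ereal (w p)"
  shows "transport_cost c \<pi> = ereal (\<Sum>p\<in>UNIV. w p * pmf \<pi> p)"
proof -
  have "c p * ereal (pmf \<pi> p) = ereal (w p * pmf \<pi> p)" for p
    using assms[of p] by (cases "p \<in> set_pmf \<pi>") (auto simp: set_pmf_iff zero_ereal_def[symmetric])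
  then show ?thesis by (simp add: transport_cost_def)
qed

lemma feasible_iff:
  assumes "\<And>p. c p \<noteq> -\<infinity>"
  shows "feasible c \<mu> \<nu> N \<longleftrightarrow> (\<exists>\<pi>\<in>restricted_couplings \<mu> \<nu> N. transport_cost c \<pi> \<noteq> \<infinity>)"
proof -
  let ?I = "INF \<pi>\<in>restricted_couplings \<mu> \<nu> N. transport_cost c \<pi>"
  have "ereal (\<Sum>p\<in>UNIV. - \<bar>real_of_ereal (c p)\<bar>) \<le> ?I"
    by (intro INF_greatest transport_cost_bounded_below assms)
  then have "?I \<noteq> -\<infinity>" by auto
  then have "feasible c \<mu> \<nu> N \<longleftrightarrow> ?I < \<infinity>" by (auto simp: feasible_def)
  also have "\<dots> \<longleftrightarrow> (\<exists>\<pi>\<in>restricted_couplings \<mu> \<nu> N. transport_cost c \<pi> < \<infinity>)"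
    by (rule INF_less_iff)
  finally show ?thesis by simp
qed

text \<open>On the support of \<open>\<pi>\<close> the mass is bounded away from 0, so a sufficiently small multiple of
  \<open>d\<close> can be added without creating negative mass there, whatever the signs of \<open>d\<close>.\<close>

lemma perturb_coupling:
  fixes \<pi> :: "('a::finite \<times> 'b::finite) pmf" and d :: "'a \<times> 'b \<Rightarrow> real"
  assumes \<pi>: "\<pi> \<in> couplings \<mu> \<nu>"
    and rows: "\<And>x. (\<Sum>y\<in>UNIV. d (x, y)) = 0" and cols: "\<And>y. (\<Sum>x\<in>UNIV. d (x, y)) = 0"
    and nonneg: "\<And>p. p \<notin> set_pmf \<pi> \<Longrightarrow> 0 \<le> d p"
  obtains \<epsilon> \<rho> where "0 < \<epsilon>" "\<rho> \<in> couplings \<mu> \<nu>" "\<And>p. pmf \<rho> p = pmf \<pi> p + \<epsilon> * d p"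
proof -
  \<comment> \<open>\<open>m\<close> is the least positive mass and \<open>D\<close> bounds \<open>\<bar>d\<bar>\<close>; the summand 1 avoids a zero divisor.\<close>
  define m where "m = Min (pmf \<pi> ` set_pmf \<pi>)"
  define D where "D = (\<Sum>p\<in>UNIV. \<bar>d p\<bar>)"
  define \<epsilon> where "\<epsilon> = m / (1 + D)"
  have m: "0 < m" "\<And>p. p \<in> set_pmf \<pi> \<Longrightarrow> m \<le> pmf \<pi> p"
    by (auto simp: m_def set_pmf_not_empty pmf_positive)
  have D: "0 \<le> D" "\<And>p. \<bar>d p\<bar> \<le> D"
    unfolding D_def by (auto intro: sum_nonneg member_le_sum)
  have "0 < \<epsilon>" using m D by (simp add: \<epsilon>_def)
  define f where "f p = pmf \<pi> p + \<epsilon> * d p" for p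
  have f_nonneg: "0 \<le> f p" for p
  proof (cases "p \<in> set_pmf \<pi>")
    case True
    have "\<epsilon> * \<bar>d p\<bar> \<le> \<epsilon> * (1 + D)"
      using \<open>0 < \<epsilon>\<close> D(2)[of p] by (intro mult_left_mono) auto
    also have "\<dots> = m" using D by (simp add: \<epsilon>_def)
    finally have "\<epsilon> * \<bar>d p\<bar> \<le> pmf \<pi> p" using m(2)[OF True] by simp
    moreover have "- (\<epsilon> * \<bar>d p\<bar>) \<le> \<epsilon> * d p"
      using \<open>0 < \<epsilon>\<close> mult_left_mono[of "- \<bar>d p\<bar>" "d p" \<epsilon>] by simp
    ultimately show ?thesis by (simp add: f_def)
  next
    case False
    then show ?thesis using nonneg \<open>0 < \<epsilon>\<close> by (simp add: f_def)
  qed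
  have f_rows: "(\<Sum>y\<in>UNIV. f (x, y)) = (\<Sum>y\<in>UNIV. pmf \<pi> (x, y))" for x
    by (simp add: f_def sum.distrib sum_distrib_left[symmetric] rows)
  have f_cols: "(\<Sum>x\<in>UNIV. f (x, y)) = (\<Sum>x\<in>UNIV. pmf \<pi> (x, y))" for y
    by (simp add: f_def sum.distrib sum_distrib_left[symmetric] cols)
  have "(\<Sum>p\<in>UNIV. f p) = (\<Sum>p\<in>UNIV. pmf \<pi> p)"
    by (simp add: sum_UNIV_prod f_rows)
  then have "(\<Sum>p\<in>UNIV. f p) = 1" by (simp add: sum_pmf_eq_1)
  then have "(\<integral>\<^sup>+p. ennreal (f p) \<partial>count_space UNIV) = 1"
    by (simp add: nn_integral_count_space_finite f_nonneg)
  then have pmf_f: "pmf (embed_pmf f) p = f p" for p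
    by (intro pmf_embed_pmf f_nonneg)
  have "embed_pmf f \<in> couplings \<mu> \<nu>"
    using \<pi> by (simp add: couplings_iff_sums pmf_f f_rows f_cols)
  with \<open>0 < \<epsilon>\<close> show thesis by (rule that) (simp add: pmf_f f_def)
qed

section \<open>Linear programming duality for the transport problem\<close>

text \<open>Farkas' lemma: a finitely generated convex cone is closed, so a point outside of it can be
  strictly separated from it; scaling turns the lower bound on the cone into a sign condition.\<close>

lemma farkas_convex_cone:
  fixes z :: "'v::euclidean_space"
  assumes "finite S" "z \<notin> convex_cone hull S"
  obtains a where "a \<bullet> z < 0" "\<And>s. s \<in> S \<Longrightarrow> 0 \<le> a \<bullet> s"
proof -
  let ?K = "convex_cone hull S"
  obtain a b where ab: "a \<bullet> z < b" "\<And>v. v \<in> ?K \<Longrightarrow> b < a \<bullet> v"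
    using separating_hyperplane_closed_point[OF convex_convex_cone_hull
        closed_convex_cone_hull[OF assms(1)] assms(2)] by blast
  have "b < 0" using ab(2)[OF convex_cone_hull_contains_0] by simp
  have "0 \<le> a \<bullet> s" if "s \<in> S" for s
  proof (rule ccontr)
    assume neg: "\<not> 0 \<le> a \<bullet> s"
    \<comment> \<open>A generator with a negative value can be scaled to value exactly \<open>b\<close>.\<close>
    have "(b / (a \<bullet> s)) *\<^sub>R s \<in> ?K"
      using neg \<open>b < 0\<close> that by (intro convex_cone_hull_mul hull_inc) (auto simp: divide_nonpos_neg)
    from ab(2)[OF this] neg show False by simp
  qed
  with ab(1) \<open>b < 0\<close> show thesis by (intro that[of a]) auto
qed

text \<open>
  Dual attainment for the transport problem with admissible cells \<open>E\<close> at a primal point with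
  support \<open>P\<close>. The hypothesis is first-order optimality: no admissible direction with zero
  marginals lowers the cost. The vectors \<open>w\<close> that have potentials form a convex cone containing
  the finitely many generators \<open>S\<close> below, and a functional that is nonnegative on all generators
  is precisely an admissible direction \<open>d\<close>; so by Farkas' lemma \<open>w\<close> lies
  in the cone that the generators span.
\<close>

lemma potentials_exist:
  fixes w :: "'a::finite \<times> 'b::finite \<Rightarrow> real" and P E :: "('a \<times> 'b) set"
  assumes dir: "\<And>d :: 'a \<times> 'b \<Rightarrow> real.
      \<lbrakk>\<And>x. (\<Sum>y\<in>UNIV. d (x, y)) = 0; \<And>y. (\<Sum>x\<in>UNIV. d (x, y)) = 0;
       \<And>p. p \<notin> E \<Longrightarrow> d p = 0; \<And>p. p \<notin> P \<Longrightarrow> 0 \<le> d p\<rbrakk>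
      \<Longrightarrow> 0 \<le> (\<Sum>p\<in>UNIV. w p * d p)"
    and "P \<subseteq> E"
  obtains \<alpha> \<beta> where "\<And>x y. (x, y) \<in> P \<Longrightarrow> \<alpha> x + \<beta> y = w (x, y)"
    and "\<And>x y. (x, y) \<in> E \<Longrightarrow> \<alpha> x + \<beta> y \<le> w (x, y)"
proof -
  define row :: "'a \<Rightarrow> real ^ ('a \<times> 'b)" where "row x = (\<chi> p. of_bool (fst p = x))" for x
  define col :: "'b \<Rightarrow> real ^ ('a \<times> 'b)" where "col y = (\<chi> p. of_bool (snd p = y))" for y
  define cell :: "'a \<times> 'b \<Rightarrow> real ^ ('a \<times> 'b)" where "cell q = (\<chi> p. of_bool (p = q))" for q
  \<comment> \<open>Both signs of a generator force the functional to vanish on it: this encodes the zero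
    marginals and \<open>d = 0\<close> off \<open>E\<close>; a single sign encodes \<open>d \<ge> 0\<close> off \<open>P\<close>.\<close>
  define S where "S = range row \<union> range (\<lambda>x. - row x) \<union> range col \<union> range (\<lambda>y. - col y)
      \<union> cell ` (- P) \<union> (\<lambda>q. - cell q) ` (- E)"
  define K where "K = {v :: real ^ ('a \<times> 'b). \<exists>\<alpha> \<beta>. (\<forall>x y. (x, y) \<in> P \<longrightarrow> \<alpha> x + \<beta> y = v $ (x, y)) \<and>
      (\<forall>x y. (x, y) \<in> E \<longrightarrow> \<alpha> x + \<beta> y \<le> v $ (x, y))}"
  have K_I: "v \<in> K" if "\<And>x y. (x, y) \<in> P \<Longrightarrow> \<alpha> x + \<beta> y = v $ (x, y)"
    "\<And>x y. (x, y) \<in> E \<Longrightarrow> \<alpha> x + \<beta> y \<le> v $ (x, y)" for v \<alpha> \<beta>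
    unfolding K_def using that by blast
  have inner_row: "a \<bullet> row x = (\<Sum>y\<in>UNIV. a $ (x, y))" for a x
    by (simp add: inner_vec_def row_def sum_UNIV_prod of_bool_def if_distrib if_distribR
        sum.swap[of _ "UNIV :: 'b set" "UNIV :: 'a set"] cong: if_cong)
  have inner_col: "a \<bullet> col y = (\<Sum>x\<in>UNIV. a $ (x, y))" for a y
    by (simp add: inner_vec_def col_def sum_UNIV_prod of_bool_def if_distrib if_distribR
         cong: if_cong)
  have inner_cell: "a \<bullet> cell q = a $ q" for a q
    by (simp add: inner_vec_def cell_def of_bool_def if_distrib if_distribR cong: if_cong)
  have "S \<subseteq> K"
  proof
    fix v assume "v \<in> S"
    then consider x where "v = row x" | x where "v = - row x" | y where "v = col y"
      | y where "v = - col y" | q where "v = cell q" "q \<notin> P" | q where "v = - cell q" "q \<notin> E"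
      unfolding S_def by blast
    then show "v \<in> K"
    proof cases
      case (1 x) then show ?thesis
        by (intro K_I[of "\<lambda>x'. of_bool (x' = x)" "\<lambda>_. 0"]) (auto simp: row_def)
    next
      case (2 x) then show ?thesis
        by (intro K_I[of "\<lambda>x'. - of_bool (x' = x)" "\<lambda>_. 0"]) (auto simp: row_def)
    next
      case (3 y) then show ?thesis
        by (intro K_I[of "\<lambda>_. 0" "\<lambda>y'. of_bool (y' = y)"]) (auto simp: col_def)
    next
      case (4 y) then show ?thesis
        by (intro K_I[of "\<lambda>_. 0" "\<lambda>y'. - of_bool (y' = y)"]) (auto simp: col_def)
    next
      case (5 q) then show ?thesis
        by (intro K_I[of "\<lambda>_. 0" "\<lambda>_. 0"]) (auto simp: cell_def)
    next
      case (6 q) then show ?thesis using \<open>P \<subseteq> E\<close>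
        by (intro K_I[of "\<lambda>_. 0" "\<lambda>_. 0"]) (auto simp: cell_def)
    qed
  qed
  moreover have "convex_cone K"
    unfolding convex_cone_iff
  proof (intro conjI ballI allI impI)
    show "0 \<in> K" by (intro K_I[of "\<lambda>_. 0" "\<lambda>_. 0"]) auto
  next
    fix u v assume "u \<in> K" "v \<in> K"
    then obtain \<alpha> \<beta> \<alpha>' \<beta>' where
      "\<And>x y. (x, y) \<in> P \<Longrightarrow> \<alpha> x + \<beta> y = u $ (x, y)" "\<And>x y. (x, y) \<in> E \<Longrightarrow> \<alpha> x + \<beta> y \<le> u $ (x, y)"
      "\<And>x y. (x, y) \<in> P \<Longrightarrow> \<alpha>' x + \<beta>' y = v $ (x, y)" "\<And>x y. (x, y) \<in> E \<Longrightarrow> \<alpha>' x + \<beta>' y \<le> v $ (x, y)"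
      unfolding K_def by blast
    note h = this
    have "(\<alpha> x + \<alpha>' x) + (\<beta> y + \<beta>' y) = (u + v) $ (x, y)" if "(x, y) \<in> P" for x y
      using h(1,3)[OF that] by simp
    moreover have "(\<alpha> x + \<alpha>' x) + (\<beta> y + \<beta>' y) \<le> (u + v) $ (x, y)" if "(x, y) \<in> E" for x y
      using h(2,4)[OF that] by simp
    ultimately show "u + v \<in> K"
      by (rule K_I[of "\<lambda>x. \<alpha> x + \<alpha>' x" "\<lambda>y. \<beta> y + \<beta>' y"])
  next
    fix v and t :: real assume "v \<in> K" "0 \<le> t"
    then obtain \<alpha> \<beta> where
      h: "\<And>x y. (x, y) \<in> P \<Longrightarrow> \<alpha> x + \<beta> y = v $ (x, y)" "\<And>x y. (x, y) \<in> E \<Longrightarrow> \<alpha> x + \<beta> y \<le> v $ (x, y)"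
      unfolding K_def by blast
    have "t * \<alpha> x + t * \<beta> y = (t *\<^sub>R v) $ (x, y)" if "(x, y) \<in> P" for x y
      using h(1)[OF that] by (simp flip: distrib_left)
    moreover have "t * \<alpha> x + t * \<beta> y \<le> (t *\<^sub>R v) $ (x, y)" if "(x, y) \<in> E" for x y
      using h(2)[OF that] \<open>0 \<le> t\<close> by (simp add: mult_left_mono flip: distrib_left)
    ultimately show "t *\<^sub>R v \<in> K"
      by (rule K_I[of "\<lambda>x. t * \<alpha> x" "\<lambda>y. t * \<beta> y"])
  qed
  ultimately have hull: "convex_cone hull S \<subseteq> K" by (rule hull_minimal)
  have "(\<chi> p. w p) \<in> convex_cone hull S"
  proof (rule ccontr)
    assume "(\<chi> p. w p) \<notin> convex_cone hull S"
    moreover have "finite S" by (simp add: S_def)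
    ultimately obtain a where a: "a \<bullet> (\<chi> p. w p) < 0" "\<And>s. s \<in> S \<Longrightarrow> 0 \<le> a \<bullet> s"
      using farkas_convex_cone by blast
    have "(\<Sum>y\<in>UNIV. a $ (x, y)) = 0" for x
      using a(2)[of "row x"] a(2)[of "- row x"] by (auto simp: S_def inner_row)
    moreover have "(\<Sum>x\<in>UNIV. a $ (x, y)) = 0" for y
      using a(2)[of "col y"] a(2)[of "- col y"] by (auto simp: S_def inner_col)
    moreover have cellP: "0 \<le> a $ p" if "p \<notin> P" for p
      using a(2)[of "cell p"] that by (auto simp: S_def inner_cell)
    moreover have "a $ p = 0" if "p \<notin> E" for p
      using a(2)[of "- cell p"] cellP[of p] that \<open>P \<subseteq> E\<close> by (auto simp: S_def inner_cell)
    ultimately have "0 \<le> (\<Sum>p\<in>UNIV. w p * a $ p)" by (intro dir) auto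
    with a(1) show False by (simp add: inner_vec_def mult.commute)
  qed
  with hull have "(\<chi> p. w p) \<in> K" by blast
  with that show thesis unfolding K_def by auto
qed

text \<open>The cells of \<open>N\<close> of infinite cost are treated as forbidden, which makes the problem one with
  real costs: a coupling of finite cost puts no mass on them, and there the
  inequality for the potentials is trivial.\<close>

lemma local_optimizer_has_potentials:
  fixes c :: "'a::finite \<times> 'b::finite \<Rightarrow> ereal"
  assumes c: "\<And>p. c p \<noteq> -\<infinity>"
    and opt: "local_primal_optimizer c \<mu> \<nu> N \<pi>"
    and fin: "transport_cost c \<pi> \<noteq> \<infinity>"
  obtains \<alpha> \<beta> where "\<And>x y. (x, y) \<in> set_pmf \<pi> \<Longrightarrow> c (x, y) = ereal (\<alpha> x + \<beta> y)"
    and "\<And>x y. (x, y) \<in> N \<Longrightarrow> ereal (\<alpha> x + \<beta> y) \<le> c (x, y)"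
proof -
  define w where "w p = real_of_ereal (c p)" for p
  define E where "E = {p \<in> N. c p \<noteq> \<infinity>}"
  have w: "c p = ereal (w p)" if "c p \<noteq> \<infinity>" for p
    using c[of p] that by (cases "c p") (auto simp: w_def)
  have \<pi>: "\<pi> \<in> couplings \<mu> \<nu>" "set_pmf \<pi> \<subseteq> N"
    and min: "\<And>\<rho>. \<rho> \<in> restricted_couplings \<mu> \<nu> N \<Longrightarrow> transport_cost c \<pi> \<le> transport_cost c \<rho>"
    using opt by (auto simp: local_primal_optimizer_def is_arg_min_linorder restricted_couplings_def)
  have spt: "set_pmf \<pi> \<subseteq> E"
    using transport_cost_finite_imp_finite_on_support[OF c fin] \<pi>(2) by (fastforce simp: E_def)
  have cost: "transport_cost c \<rho> = ereal (\<Sum>p\<in>UNIV. w p * pmf \<rho> p)" if "set_pmf \<rho> \<subseteq> E" for \<rho>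
    using that by (intro transport_cost_eq_real_sum w) (auto simp: E_def)
  have "0 \<le> (\<Sum>p\<in>UNIV. w p * d p)"
    if d: "\<And>x. (\<Sum>y\<in>UNIV. d (x, y)) = 0" "\<And>y. (\<Sum>x\<in>UNIV. d (x, y)) = 0"
      "\<And>p. p \<notin> E \<Longrightarrow> d p = 0" "\<And>p. p \<notin> set_pmf \<pi> \<Longrightarrow> 0 \<le> d p" for d
  proof -
    obtain \<epsilon> \<rho> where \<rho>: "0 < \<epsilon>" "\<rho> \<in> couplings \<mu> \<nu>" "\<And>p. pmf \<rho> p = pmf \<pi> p + \<epsilon> * d p"
      using perturb_coupling[OF \<pi>(1) d(1,2,4)] by blast
    have spt\<rho>: "set_pmf \<rho> \<subseteq> E"
      proof
      fix p assume "p \<in> set_pmf \<rho>"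
      then have "pmf \<pi> p \<noteq> 0 \<or> d p \<noteq> 0" by (auto simp: set_pmf_iff \<rho>(3))
      then show "p \<in> E" using spt d(3)[of p] by (auto simp: set_pmf_iff)
    qed
    then have "\<rho> \<in> restricted_couplings \<mu> \<nu> N"
      using \<rho>(2) by (auto simp: restricted_couplings_def E_def)
    from min[OF this] have "0 \<le> \<epsilon> * (\<Sum>p\<in>UNIV. w p * d p)"
      by (simp add: cost spt spt\<rho> \<rho>(3) distrib_left sum.distrib sum_distrib_left mult.left_commute)
    with \<rho>(1) show ?thesis by (simp add: zero_le_mult_iff)
  qed
  from potentials_exist[OF this spt]
  obtain \<alpha> \<beta> where ab: "\<And>x y. (x, y) \<in> set_pmf \<pi> \<Longrightarrow> \<alpha> x + \<beta> y = w (x, y)"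
    "\<And>x y. (x, y) \<in> E \<Longrightarrow> \<alpha> x + \<beta> y \<le> w (x, y)"
    by blast
  show thesis
  proof (rule that)
    show "c (x, y) = ereal (\<alpha> x + \<beta> y)" if "(x, y) \<in> set_pmf \<pi>" for x y
      using ab(1)[OF that] w[of "(x, y)"] spt that by (auto simp: E_def)
    show "ereal (\<alpha> x + \<beta> y) \<le> c (x, y)" if "(x, y) \<in> N" for x y
      using ab(2)[of x y] w[of "(x, y)"] that by (cases "c (x, y) = \<infinity>") (auto simp: E_def)
  qed
qed

text \<open>Weak duality: integrated against a coupling, \<open>\<alpha> x + \<beta> y\<close> gives the same value \<open>D\<close> for all
  couplings; it bounds every cost from below and is the cost of \<open>\<pi>\<close>.\<close>

lemma potentials_imp_global_optimizer:
  fixes c :: "'a::finite \<times> 'b::finite \<Rightarrow> ereal"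
  assumes \<pi>: "\<pi> \<in> couplings \<mu> \<nu>"
    and spt: "\<And>x y. (x, y) \<in> set_pmf \<pi> \<Longrightarrow> c (x, y) = ereal (\<alpha> x + \<beta> y)"
    and le: "\<And>x y. ereal (\<alpha> x + \<beta> y) \<le> c (x, y)"
  shows "global_primal_optimizer c \<mu> \<nu> \<pi>"
proof -
  define D where "D = (\<Sum>x\<in>UNIV. \<alpha> x * pmf \<mu> x) + (\<Sum>y\<in>UNIV. \<beta> y * pmf \<nu> y)"
  have dual: "(\<Sum>p\<in>UNIV. (\<alpha> (fst p) + \<beta> (snd p)) * pmf \<rho> p) = D" if "\<rho> \<in> couplings \<mu> \<nu>" for \<rho>
  proof -
    have "(\<Sum>p\<in>UNIV. (\<alpha> (fst p) + \<beta> (snd p)) * pmf \<rho> p) =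
      (\<Sum>x\<in>UNIV. \<Sum>y\<in>UNIV. \<alpha> x * pmf \<rho> (x, y)) + (\<Sum>x\<in>UNIV. \<Sum>y\<in>UNIV. \<beta> y * pmf \<rho> (x, y))"
      by (simp add: sum_UNIV_prod distrib_right sum.distrib)
    also have "(\<Sum>x\<in>UNIV. \<Sum>y\<in>UNIV. \<beta> y * pmf \<rho> (x, y)) = (\<Sum>y\<in>UNIV. \<Sum>x\<in>UNIV. \<beta> y * pmf \<rho> (x, y))"
      by (rule sum.swap)
    finally show ?thesis
      using that by (simp add: D_def couplings_iff_sums flip: sum_distrib_left)
  qed
  have "transport_cost c \<pi> = ereal D"
    using transport_cost_eq_real_sum[of \<pi> c "\<lambda>p. \<alpha> (fst p) + \<beta> (snd p)"] spt dual[OF \<pi>] by force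
  moreover have "ereal D \<le> transport_cost c \<rho>" if "\<rho> \<in> couplings \<mu> \<nu>" for \<rho>
  proof -
    have "ereal ((\<alpha> (fst p) + \<beta> (snd p)) * pmf \<rho> p) \<le> c p * ereal (pmf \<rho> p)" for p
      using ereal_mult_right_mono[OF le[of "fst p" "snd p"], of "ereal (pmf \<rho> p)"]
      by (simp add: pmf_nonneg)
    then show ?thesis
      unfolding transport_cost_def dual[OF that, symmetric] sum_ereal[symmetric]
      by (intro sum_mono) simp
  qed
  ultimately show ?thesis
    using \<pi> by (simp add: global_primal_optimizer_def is_arg_min_linorder)
qed

section \<open>Shielding makes local optimality global\<close>

text \<open>
  The shielding inequality with \<open>c (xs, ys)\<close> replaced by \<open>\<alpha> xs + \<beta> ys\<close> and \<open>c (xA, ys)\<close> by its lower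
  bound; \<open>\<beta> ys\<close> cancels. The strict inequality keeps its right-hand side from being \<open>\<infinity>\<close> and its
  left-hand side from being \<open>-\<infinity>\<close>, and \<open>\<infinity> - \<infinity>\<close> is excluded, so \<open>c (xA, ys)\<close> and \<open>c (xs, yB)\<close> are
  finite; only \<open>c (xA, yB)\<close> may be \<open>\<infinity>\<close>.
\<close>

lemma shields_imp_smaller_slack:
  assumes "\<And>p. c p \<noteq> -\<infinity>"
    and "shields c (xs, ys) xA yB"
    and "c (xs, ys) = ereal (\<alpha> xs + \<beta> ys)"
    and "ereal (\<alpha> xA + \<beta> ys) \<le> c (xA, ys)"
  shows "c (xs, yB) - ereal (\<alpha> xs) < c (xA, yB) - ereal (\<alpha> xA)"
  using assms(1)[of "(xs, yB)"] assms(1)[of "(xA, yB)"] assms(2-)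
  by (cases "c (xA, ys)"; cases "c (xs, yB)"; cases "c (xA, yB)") (auto simp: shields_def)

text \<open>A cell of column \<open>y\<close> outside \<open>N\<close> is shielded, so some cell of the same column has smaller
  slack. Hence a cell of least slack belongs to \<open>N\<close>, and it bounds the whole column.\<close>

lemma shielding_extends_dual_feasibility:
  fixes c :: "'a::finite \<times> 'b \<Rightarrow> ereal"
  assumes c: "\<And>p. c p \<noteq> -\<infinity>"
    and sh: "shielding c \<pi> N"
    and spt: "\<And>x y. (x, y) \<in> set_pmf \<pi> \<Longrightarrow> c (x, y) = ereal (\<alpha> x + \<beta> y)"
    and N: "\<And>x y. (x, y) \<in> N \<Longrightarrow> ereal (\<alpha> x + \<beta> y) \<le> c (x, y)"
  shows "ereal (\<alpha> x + \<beta> y) \<le> c (x, y)"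
proof -
  \<comment> \<open>The term \<open>\<beta> y\<close> is constant along the column and is left out.\<close>
  define slack where "slack x = c (x, y) - ereal (\<alpha> x)" for x
  have "Min (range slack) \<in> range slack" by (intro Min_in) auto
  then obtain x0 where "slack x0 = Min (range slack)" by (metis rangeE)
  then have min: "slack x0 \<le> slack x" for x by simp
  have "(x0, y) \<in> N"
  proof (rule ccontr)
    assume "(x0, y) \<notin> N"
    then obtain xs ys where
      "(xs, ys) \<in> set_pmf \<pi>" "(x0, ys) \<in> N" "shields c (xs, ys) x0 y"
      using sh unfolding shielding_def by blast
    then have "slack xs < slack x0"
      unfolding slack_def by (intro shields_imp_smaller_slack[where \<beta> = \<beta>, OF c] spt N)
    with min[of xs] show False by simp
  qed
  from N[OF this] have "ereal (\<beta> y) \<le> slack x0"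
    unfolding slack_def by (cases "c (x0, y)") auto
  also have "\<dots> \<le> slack x" by (rule min)
  finally show ?thesis
    unfolding slack_def by (cases "c (x, y)") auto
qed

lemma shielded_local_optimizer_is_global:
  fixes c :: "'a::finite \<times> 'b::finite \<Rightarrow> ereal"
  assumes c: "\<And>p. c p \<noteq> -\<infinity>"
    and opt: "local_primal_optimizer c \<mu> \<nu> N \<pi>"
    and fin: "transport_cost c \<pi> \<noteq> \<infinity>"
    and sh: "shielding c \<pi> N"
  shows "global_primal_optimizer c \<mu> \<nu> \<pi>"
proof -
  obtain \<alpha> \<beta> where spt: "\<And>x y. (x, y) \<in> set_pmf \<pi> \<Longrightarrow> c (x, y) = ereal (\<alpha> x + \<beta> y)"
    and N: "\<And>x y. (x, y) \<in> N \<Longrightarrow> ereal (\<alpha> x + \<beta> y) \<le> c (x, y)"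
    using local_optimizer_has_potentials[OF c opt fin] by blast
  have \<pi>: "\<pi> \<in> couplings \<mu> \<nu>"
    using opt by (auto simp: local_primal_optimizer_def is_arg_min_def restricted_couplings_def)
  have "ereal (\<alpha> x + \<beta> y) \<le> c (x, y)" for x y
    by (rule shielding_extends_dual_feasibility[where \<alpha> = \<alpha> and \<beta> = \<beta>]) (fact c sh spt N)+
  with \<pi> spt show ?thesis
    by (rule potentials_imp_global_optimizer[where \<alpha> = \<alpha> and \<beta> = \<beta>])
qed

section \<open>The iteration\<close>

theorem proposition4p2:
  fixes c :: "'a::finite \<times> 'b::finite \<Rightarrow> ereal"
    and \<mu> :: "'a pmf" and \<nu> :: "'b pmf"
    and solveLocal :: "('a \<times> 'b) set \<Rightarrow> ('a \<times> 'b) pmf"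
    and shield :: "('a \<times> 'b) pmf \<Rightarrow> ('a \<times> 'b) set"
    and N\<^sub>1 :: "('a \<times> 'b) set"
  assumes "\<And>p. c p \<noteq> -\<infinity>"
    and "\<And>N. solveLocal N \<in> couplings \<mu> \<nu>"
    and "\<And>N. feasible c \<mu> \<nu> N \<Longrightarrow> local_primal_optimizer c \<mu> \<nu> N (solveLocal N)"
    and "\<And>\<pi>. \<pi> \<in> couplings \<mu> \<nu> \<Longrightarrow> shielding c \<pi> (shield \<pi>)"
    and "feasible c \<mu> \<nu> N\<^sub>1"
  shows "\<exists>\<pi> N. solveSparse c solveLocal shield N\<^sub>1 = Some (\<pi>, N) \<and>
           global_primal_optimizer c \<mu> \<nu> \<pi>"
proof -
  note c = assms(1) and coupling = assms(2) and local_opt = assms(3) and sh = assms(4)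
  let ?C = "transport_cost c"
  have le: "?C (solveLocal N) \<le> ?C \<rho>"
    if "feasible c \<mu> \<nu> N" "\<rho> \<in> restricted_couplings \<mu> \<nu> N" for N \<rho>
    using local_opt[OF that(1)] that(2) by (simp add: local_primal_optimizer_def is_arg_min_linorder)
  have fin: "?C (solveLocal N) \<noteq> \<infinity>" if feas: "feasible c \<mu> \<nu> N" for N
  proof -
    obtain \<rho> where "\<rho> \<in> restricted_couplings \<mu> \<nu> N" "?C \<rho> \<noteq> \<infinity>"
      using feas by (auto simp: feasible_iff[OF c])
    with le[OF feas] show ?thesis by force
  qed
  have self: "\<pi> \<in> restricted_couplings \<mu> \<nu> (shield \<pi>)" if "\<pi> \<in> couplings \<mu> \<nu>" for \<pi>
    using sh[OF that] that by (simp add: restricted_couplings_def shielding_def)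
  have feas_shield: "feasible c \<mu> \<nu> (shield \<pi>)" if "\<pi> \<in> couplings \<mu> \<nu>" "?C \<pi> \<noteq> \<infinity>" for \<pi>
    using self[OF that(1)] that(2) by (auto simp: feasible_iff[OF c])

  define inv where "inv = (\<lambda>(k::nat, \<pi>', \<pi>, N). 2 \<le> k \<and> N = shield \<pi> \<and>
      (\<exists>M. feasible c \<mu> \<nu> M \<and> \<pi> = solveLocal M) \<and>
      (2 < k \<longrightarrow> \<pi>' \<in> couplings \<mu> \<nu> \<and> ?C \<pi>' \<noteq> \<infinity> \<and> \<pi> = solveLocal (shield \<pi>')))"
  \<comment> \<open>The rank counts the neighbourhoods whose local optimum beats the previous coupling. After
    the first pass there is no previous coupling, and all neighbourhoods count. A pass that does
    not start in a stopping state removes at least the neighbourhood \<open>M\<close> that produced the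
    current coupling.\<close>
  define rank where "rank = (\<lambda>(k::nat, \<pi>', \<pi> :: ('a \<times> 'b) pmf, N :: ('a \<times> 'b) set).
      card {M. 2 < k \<longrightarrow> ?C (solveLocal M) < ?C \<pi>'})"
  let ?pass = "sparse_pass solveLocal shield"
  let ?s = "?pass (1, undefined, undefined, N\<^sub>1)"
  have init: "inv ?s"
    using assms(5) by (auto simp: inv_def sparse_pass_def Let_def)
  have step: "inv (?pass s) \<and> rank (?pass s) < rank s"
    if "inv s" "\<not> sparse_stop c s" for s
  proof -
    obtain k \<pi>' \<pi> N where s: "s = (k, \<pi>', \<pi>, N)" by (cases s) auto
    from \<open>inv s\<close> obtain M where k: "2 \<le> k" and N: "N = shield \<pi>"
      and M: "feasible c \<mu> \<nu> M" "\<pi> = solveLocal M"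
      and prev: "2 < k \<Longrightarrow> \<pi>' \<in> couplings \<mu> \<nu> \<and> ?C \<pi>' \<noteq> \<infinity> \<and> \<pi> = solveLocal (shield \<pi>')"
      by (auto simp: inv_def s)
    have \<pi>: "\<pi> \<in> couplings \<mu> \<nu>" "?C \<pi> \<noteq> \<infinity>"
      using M coupling fin by auto
    have pass: "?pass s = (k + 1, \<pi>, solveLocal N, shield (solveLocal N))"
      by (simp add: s sparse_pass_def Let_def)
    have "inv (?pass s)"
      using k \<pi> feas_shield[OF \<pi>] unfolding pass inv_def by (auto simp: N)
    moreover have "rank (?pass s) < rank s"
    proof -
      have decrease: "?C \<pi> < ?C \<pi>'" if "2 < k"
        using le[OF feas_shield self] prev[OF that] \<open>\<not> sparse_stop c s\<close> that
        by (auto simp: s sparse_stop_def order_less_le)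
      have "M \<in> {M. 2 < k \<longrightarrow> ?C (solveLocal M) < ?C \<pi>'} - {M. ?C (solveLocal M) < ?C \<pi>}"
        using decrease M by auto
      moreover have "{M. ?C (solveLocal M) < ?C \<pi>} \<subseteq> {M. 2 < k \<longrightarrow> ?C (solveLocal M) < ?C \<pi>'}"
        using decrease by (auto intro: less_trans)
      ultimately have "{M. ?C (solveLocal M) < ?C \<pi>} \<subset> {M. 2 < k \<longrightarrow> ?C (solveLocal M) < ?C \<pi>'}"
        by blast
      then have "card {M. ?C (solveLocal M) < ?C \<pi>} < card {M. 2 < k \<longrightarrow> ?C (solveLocal M) < ?C \<pi>'}"
        by (intro psubset_card_mono) auto
      moreover have "rank (?pass s) = card {M. ?C (solveLocal M) < ?C \<pi>}"
        using k unfolding pass rank_def by simp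
      ultimately show ?thesis by (simp add: rank_def s)
    qed
    ultimately show ?thesis ..
  qed
  obtain t where t: "while_option (\<lambda>s. \<not> sparse_stop c s) ?pass ?s = Some t"
    using measure_while_option_Some[of inv "\<lambda>s. \<not> sparse_stop c s" ?pass rank, OF step init] by blast
  have "inv t" using while_option_rule[of inv, OF _ t init] step by blast
  moreover have "sparse_stop c t" using while_option_stop[OF t] by simp
  ultimately obtain k \<pi>' \<pi> N where tt: "t = (k, \<pi>', \<pi>, N)"
    and \<pi>': "\<pi>' \<in> couplings \<mu> \<nu>" "?C \<pi>' \<noteq> \<infinity>" and \<pi>: "\<pi> = solveLocal (shield \<pi>')"
    and eq: "?C \<pi> = ?C \<pi>'"
    by (cases t) (auto simp: inv_def sparse_stop_def)
  \<comment> \<open>The neighbourhood \<open>shield \<pi>'\<close> is shielding for \<open>\<pi>'\<close>, but perhaps not for \<open>\<pi>\<close>; so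
    global optimality is shown for \<open>\<pi>'\<close> and transferred by equality of costs.\<close>
  have "local_primal_optimizer c \<mu> \<nu> (shield \<pi>') \<pi>'"
    using local_opt[OF feas_shield[OF \<pi>']] self[OF \<pi>'(1)] eq \<pi>
    by (simp add: local_primal_optimizer_def is_arg_min_linorder)
  then have "global_primal_optimizer c \<mu> \<nu> \<pi>'"
    by (rule shielded_local_optimizer_is_global[OF c _ \<pi>'(2) sh[OF \<pi>'(1)]])
  then have "global_primal_optimizer c \<mu> \<nu> \<pi>"
    using eq coupling[of "shield \<pi>'"] \<pi> by (simp add: global_primal_optimizer_def is_arg_min_linorder)
  moreover have "solveSparse c solveLocal shield N\<^sub>1 = Some (\<pi>, N)"
    unfolding solveSparse_def t tt by simp
  ultimately show ?thesis by blast
qed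

end
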